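(* Let $T$ be a finite set with $N=|T|\ge2$, put $p=\log N$, let $m$ be an integer, and let $A_t\subset[d]$ ($t\in T$) satisfy $|A_t|\le m$. For each $t\in T$ let $K_t\subset\mathbb R_+^d$ be a nonempty compact convex downward-closed set all of whose elements are supported on $A_t$. Suppose $u>0$ and $$\max\left\{h_{K_t}(\mathbf 1_{A_t\setminus A_s}),\ h_{K_s}(\mathbf 1_{A_s\setminus A_t})\right\}\ge u\qquad\text{for all } s\ne t\text{ in }T .$$ Then there are a probability law $\nu$ on the (finite) set of admissible encoders such that $$a_t:=\frac{u}{2p}\,\mathbb E_{E\sim\nu}\,\tau_t^E\in K_t\qquad\text{for every }t\in T,$$ and a subset $T'\subset T$ with $$|T'|\ge\frac{e^p}{1+2B_m e^{p/4}},\qquad B_m=(m+1)4^m,$$ such that $$a_t(A_t\setminus A_s)\ge \frac u8\qquad\text{for all } t\ne s\text{ in }T' .$$ If moreover $m\ge1$ and $m\le p/64$, then $|T'|\ge e^{p/2}$.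
   Context: $[d]=\{1,\dots,d\}$; logarithms are natural; $\mathbf 1_D\in\mathbb R^d$ is the indicator vector of $D\subset[d]$; for $v\in\mathbb R_+^d$ and $D\subset[d]$, $v(D)=\sum_{i\in D}v_i$. For compact $K\subset\mathbb R_+^d$, $h_K(w)=\max_{v\in K}\langle w,v\rangle$. $K$ is downward closed if $0\le z\le v\in K$ (coordinatewise) implies $z\in K$. Encoders. Fix once and for all a linear ordering of $[d]$. An admissible encoder $E$ (for the family $(A_t)_{t\in T}$) is a complete family $(C_t)_{t\in T}$ of pairwise distinct sets with $C_t\subset A_t$ for all $t\in T$. Given $E$, associate to it vectors $\tau_t^E\in\mathbb R_+^d$, $t\in T$, as follows. Partition the labels by $k=|C_t|$, and let $N_k$ be the number of labels with $|C_t|=k$. For a label $t$ with $|C_t|=k$, write $C_t$ as a word $(i_1,\dots,i_k)$ listed in the fixed order. For $0\le j\le k$ let $n_j(t)$ be the number of labels $t'$ with $|C_{t'}|=k$ whose word has the same first $j$ coordinates as that of $t$ (so $n_0(t)=N_k$ and $n_k(t)=1$). Set $\tau^E_{i_j}(t)=\log\frac{n_{j-1}(t)}{n_j(t)}$ for $1\le j\le k$, and $\tau^E_i(t)=0$ for $i\notin C_t$; then $\tau_t^E=(\tau_i^E(t))_{i\in[d]}$. *)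

theory Defs
  imports "HOL-Probability.Probability"
begin

text \<open>
  The index set $[d]$ is a type of class \<open>{finite, linorder}\<close>. Its order is the linear
  ordering of $[d]$ that is fixed once and for all; since the type is arbitrary, so is that ordering.
\<close>

definition indvec :: "'d::finite set \<Rightarrow> real^'d"
  where "indvec D = (\<chi> i. indicator D i)"

definition mass :: "real^'d::finite \<Rightarrow> 'd set \<Rightarrow> real"
  where "mass v D = (\<Sum>i\<in>D. v $ i)"

text \<open>On nonempty compact sets, the only ones to which it is applied, this supremum is a maximum
  (\<open>support_fun_max\<close> below).\<close>

definition support_fun :: "(real^'d::finite) set \<Rightarrow> real^'d \<Rightarrow> real"
  where "support_fun K w = (SUP v\<in>K. w \<bullet> v)"

text \<open>The order on vectors is the coordinatewise one.\<close>

definition downward_closed :: "(real^'d::finite) set \<Rightarrow> bool"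
  where "downward_closed K \<longleftrightarrow> (\<forall>v\<in>K. \<forall>z. 0 \<le> z \<and> z \<le> v \<longrightarrow> z \<in> K)"

text \<open>
  Families indexed by \<open>T\<close> are functions that are \<open>undefined\<close> outside \<open>T\<close>, so that the set of
  admissible encoders is finite.
\<close>

definition encoders :: "'a set \<Rightarrow> ('a \<Rightarrow> 'd set) \<Rightarrow> ('a \<Rightarrow> 'd set) set"
  where "encoders T A = {C \<in> (\<Pi>\<^sub>E t\<in>T. Pow (A t)). inj_on C T}"

text \<open>The word $(i_1,\dots,i_k)$ of a set; list positions start at 0, so $i_j$ is
  \<open>word D ! (j - 1)\<close>.\<close>

definition word :: "'d::{finite,linorder} set \<Rightarrow> 'd list"
  where "word D = sorted_list_of_set D"

definition prefix_count ::
    "'a set \<Rightarrow> ('a \<Rightarrow> 'd::{finite,linorder} set) \<Rightarrow> 'a \<Rightarrow> nat \<Rightarrow> nat"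
  where "prefix_count T C t j =
    card {t' \<in> T. card (C t') = card (C t) \<and> take j (word (C t')) = take j (word (C t))}"

text \<open>The letters of a word are distinct, so at most one summand contributes to each coordinate;
  see \<open>tau_word\<close> and \<open>tau_outside\<close>.\<close>

definition tau ::
    "'a set \<Rightarrow> ('a \<Rightarrow> 'd::{finite,linorder} set) \<Rightarrow> 'a \<Rightarrow> real^('d::{finite,linorder})"
  where "tau T C t = (\<Sum>j = 1..card (C t).
    axis (word (C t) ! (j - 1)) (ln (real (prefix_count T C t (j - 1)) / real (prefix_count T C t j))))"

lemma support_fun_max:
  assumes "compact K" "K \<noteq> {}"
  shows "\<exists>v\<in>K. support_fun K w = w \<bullet> v \<and> (\<forall>x\<in>K. w \<bullet> x \<le> w \<bullet> v)"
proof -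
  have "continuous_on K (\<lambda>v. w \<bullet> v)" by (intro continuous_intros)
  then obtain v where v: "v \<in> K" "\<forall>x\<in>K. w \<bullet> x \<le> w \<bullet> v"
    using continuous_attains_sup[OF assms] by blast
  then have "(SUP x\<in>K. w \<bullet> x) = w \<bullet> v"
    by (intro cSup_eq_maximum) auto
  with v show ?thesis unfolding support_fun_def by blast
qed

lemma finite_encoders:
  fixes A :: "'a \<Rightarrow> 'd::finite set"
  assumes "finite T"
  shows "finite (encoders T A)"
  unfolding encoders_def using finite_PiE[OF assms, of "\<lambda>t. Pow (A t)"] by simp

lemma tau_word:
  assumes "1 \<le> j" "j \<le> card (C t)"
  shows "tau T C t $ (word (C t) ! (j - 1)) =
    ln (real (prefix_count T C t (j - 1)) / real (prefix_count T C t j))"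
proof -
  have eq: "word (C t) ! (j - 1) = word (C t) ! (l - 1) \<longleftrightarrow> l = j" if "l \<in> {1..card (C t)}" for l
  proof -
    have "l - 1 < card (C t)" "j - 1 < card (C t)" "l - 1 = j - 1 \<longleftrightarrow> l = j"
      using that assms by auto
    then show ?thesis
      using nth_eq_iff_index_eq[of "word (C t)" "l - 1" "j - 1"] by (auto simp: word_def)
  qed
  have "tau T C t $ (word (C t) ! (j - 1)) = (\<Sum>l = 1..card (C t). if l = j then
    ln (real (prefix_count T C t (j - 1)) / real (prefix_count T C t j)) else 0)"
    unfolding tau_def sum_component by (intro sum.cong refl) (simp add: axis_def eq del: One_nat_def)
  then show ?thesis using assms by simp
qed

lemma tau_outside:
  assumes "i \<notin> C t"
  shows "tau T C t $ i = 0"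
proof -
  have "word (C t) ! (l - 1) \<noteq> i" if "l \<in> {1..card (C t)}" for l
    using that assms nth_mem[of "l - 1" "word (C t)"] by (auto simp: word_def)
  then show ?thesis unfolding tau_def sum_component
    by (intro sum.neutral ballI) (auto simp: axis_def)
qed

end

theory Submission
  imports Defs
begin

text \<open>
  Two independent facts about the vectors \<open>tau T C t\<close> carry the theorem. Choose a label uniformly
  among those whose code set has a given size $k$ and read its word letter by letter: the value of
  \<open>tau\<close> at a letter is minus the logarithm of its conditional probability given the letters before it.

  \<^bold>\<open>Upper bound: membership in $K_t$.\<close> The total mass of $\tau_t$ is the logarithm of the number of
  labels with the same code size, hence at most $p$ (\<open>mass_tau_UNIV_le\<close>). By separation in the product
  of the spaces, a law with averaged vectors in all the $K_t$ exists as soon as for every choice of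
  linear functionals $w_t$ a single encoder satisfies
  $\frac{u}{2p}\sum_t\langle w_t,\tau_t\rangle\le\sum_t h_{K_t}(w_t)$
  (\<open>expectation_in_product_if_no_separation\<close>). The encoder that keeps in $C_t$ exactly the coordinates of
  $A_t$ where $w_t\le\theta_t=h_{K_t}(w_t)/u$ does this label by label, since
  $\langle w_t,\tau_t\rangle\le\theta_t\,p$. Its sets are distinct: if $C_s=C_t$, then $w_t>\theta_t$ on
  $A_t\setminus A_s$ and $w_s>\theta_s$ on $A_s\setminus A_t$, which forces both support functions in the
  hypothesis below $u$ (\<open>threshold_encoder\<close>).

  \<^bold>\<open>Lower bound: separation of most pairs.\<close> Fix $s$ and an encoder. The number
  $\exp(-\tau_t(A_t\setminus A_s))$ is the product of the conditional probabilities of the letters of the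
  word of $t$ outside $A_s$. Once the positions and the values of the letters in $A_s$ are prescribed,
  these products sum to at most 1 (\<open>kraft_revealed\<close>). There are at most $2^k2^m$ prescriptions for each
  of the $m+1$ possible lengths $k\le m$, so
  $\sum_t\exp(-\tau_t(A_t\setminus A_s))\le(m+1)4^m=B_m$ (\<open>kraft_encoder\<close>). By convexity of \<open>exp\<close> the same
  holds after averaging over encoders, and so for each $s$ at most $B_me^{p/4}$ labels $t$ have averaged
  mass below $p/4$ on $A_t\setminus A_s$ (\<open>few_labels_with_little_mass\<close>). The bad pairs thus form a directed
  graph with indegrees at most $B_me^{p/4}$, and such a graph has a large independent set
  (\<open>independent_set_of_bounded_indegree\<close>); this is $T'$.
\<close>

section \<open>Barycentres and separation\<close>

text \<open>
  The coefficients of a convex combination sit on the points of \<open>f ` S\<close>. As \<open>f\<close> may identify elements of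
  \<open>S\<close>, the law is put on a subset \<open>R\<close> on which \<open>f\<close> is injective and takes the same values.
\<close>

lemma convex_hull_imp_expectation:
  fixes f :: "'e \<Rightarrow> 'n::euclidean_space"
  assumes "finite S" and "x \<in> convex hull (f ` S)"
  obtains \<nu> where "set_pmf \<nu> \<subseteq> S" "measure_pmf.expectation \<nu> f = x"
proof -
  from assms obtain c where c: "\<forall>y\<in>f ` S. 0 \<le> c y" "sum c (f ` S) = 1" "(\<Sum>y\<in>f ` S. c y *\<^sub>R y) = x"
    by (auto simp: convex_hull_finite)
  obtain R where R: "R \<subseteq> S" "inj_on f R" "f ` S = f ` R"
    using subset_image_inj[of "f ` S" f S] by auto
  have "finite R" using R assms finite_subset by blast
  define q where "q e = (if e \<in> R then c (f e) else 0)" for e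
  have q_nonneg: "q e \<ge> 0" for e using c(1) R by (auto simp: q_def)
  have "(\<integral>\<^sup>+e. ennreal (q e) \<partial>count_space UNIV) = (\<Sum>e\<in>R. ennreal (q e))"
    using \<open>finite R\<close> by (intro nn_integral_count_space') (auto simp: q_def)
  also have "\<dots> = ennreal (\<Sum>e\<in>R. q e)" using q_nonneg by (simp add: sum_ennreal)
  also have "(\<Sum>e\<in>R. q e) = sum c (f ` S)"
    unfolding R(3) using R(2) by (simp add: sum.reindex q_def)
  finally have q_prob: "(\<integral>\<^sup>+e. ennreal (q e) \<partial>count_space UNIV) = 1" using c(2) by simp
  define \<nu> where "\<nu> = embed_pmf q"
  have pmf_\<nu>: "pmf \<nu> e = q e" for e
    unfolding \<nu>_def by (rule pmf_embed_pmf[OF q_nonneg q_prob])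
  have set_\<nu>: "set_pmf \<nu> \<subseteq> R"
    by (auto simp: set_pmf_eq pmf_\<nu> q_def split: if_splits)
  have "measure_pmf.expectation \<nu> f = (\<Sum>e\<in>R. pmf \<nu> e *\<^sub>R f e)"
    using set_\<nu> by (intro integral_measure_pmf[OF \<open>finite R\<close>]) auto
  also have "\<dots> = (\<Sum>y\<in>f ` S. c y *\<^sub>R y)"
    unfolding R(3) using R(2) by (simp add: sum.reindex pmf_\<nu> q_def)
  finally have "measure_pmf.expectation \<nu> f = x" using c(3) by simp
  then show thesis using that set_\<nu> R(1) by blast
qed

text \<open>
  If the convex hull of the families \<open>(f e t)\<^sub>t\<close> missed the product of the sets \<open>K t\<close>, a hyperplane would
  separate the two compact convex sets, and its normal vector would contradict the last assumption.
  The separation takes place in a Euclidean space whose coordinates must be indexed by a finite type,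
  whereas \<open>T\<close> is a finite set in an arbitrary type; the injection \<open>g\<close> renames the labels.
\<close>

lemma expectation_in_product_if_no_separation:
  fixes f :: "'e \<Rightarrow> 'a \<Rightarrow> real^'d::finite"
    and K :: "'a \<Rightarrow> (real^'d) set"
    and g :: "'a \<Rightarrow> 'i::finite"
  assumes "finite T" and inj: "inj_on g T" and S: "finite S"
    and K: "\<And>t. t \<in> T \<Longrightarrow> K t \<noteq> {}" "\<And>t. t \<in> T \<Longrightarrow> compact (K t)" "\<And>t. t \<in> T \<Longrightarrow> convex (K t)"
    and no_sep: "\<And>w. \<exists>e\<in>S. (\<Sum>t\<in>T. w t \<bullet> f e t) \<le> (\<Sum>t\<in>T. support_fun (K t) (w t))"
  shows "\<exists>\<nu>. set_pmf \<nu> \<subseteq> S \<and> (\<forall>t\<in>T. measure_pmf.expectation \<nu> (\<lambda>e. f e t) \<in> K t)"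
proof -
  \<comment> \<open>\<open>G\<close> turns a family on \<open>T\<close> into a vector; coordinates that name no label are set to 0.\<close>
  define G :: "('a \<Rightarrow> real^'d) \<Rightarrow> real^'d^'i"
    where "G y = (\<chi> i. if i \<in> g ` T then y (inv_into T g i) else 0)" for y
  have G_nth: "G y $ g t = y t" if "t \<in> T" for y t
    using that inj by (simp add: G_def)
  have G_inner: "a \<bullet> G y = (\<Sum>t\<in>T. a $ g t \<bullet> y t)" for a y
  proof -
    have "a \<bullet> G y = (\<Sum>i\<in>UNIV. a $ i \<bullet> G y $ i)" by (simp add: inner_vec_def)
    also have "\<dots> = (\<Sum>i\<in>g ` T. a $ i \<bullet> G y $ i)"
      by (intro sum.mono_neutral_right) (auto simp: G_def)
    also have "\<dots> = (\<Sum>t\<in>T. a $ g t \<bullet> y t)"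
      using inj by (simp add: sum.reindex G_nth)
    finally show ?thesis .
  qed
  define H where "H = convex hull ((\<lambda>e. G (f e)) ` S)"
  define P where "P = {x. \<forall>t\<in>T. x $ g t \<in> K t}"
  have "compact H" unfolding H_def using S by (simp add: finite_imp_compact_convex_hull)
  have "H \<noteq> {}" unfolding H_def using no_sep by auto
  have P_Inter: "P = (\<Inter>t\<in>T. (\<lambda>x. x $ g t) -` K t)" by (auto simp: P_def)
  have "closed P"
    unfolding P_Inter using K(2) by (intro closed_INT ballI closed_vimage compact_imp_closed continuous_intros) auto
  have "convex P"
    unfolding P_Inter using K(3)
    by (intro convex_INT convex_linear_vimage bounded_linear.linear[OF bounded_linear_vec_nth]) auto
  have "H \<inter> P \<noteq> {}"
  proof
    assume "H \<inter> P = {}"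
    then obtain a b where a: "\<forall>x\<in>H. a \<bullet> x < b" "\<forall>x\<in>P. a \<bullet> x > b"
      using separating_hyperplane_compact_closed[of H P] \<open>compact H\<close> \<open>H \<noteq> {}\<close> \<open>closed P\<close> \<open>convex P\<close>
      by (auto simp: H_def)
    \<comment> \<open>The functional is smaller on the hull than on the product, so its negative is the offending one.\<close>
    define w where "w t = - (a $ g t)" for t
    obtain e where e: "e \<in> S" "(\<Sum>t\<in>T. w t \<bullet> f e t) \<le> (\<Sum>t\<in>T. support_fun (K t) (w t))"
      using no_sep by blast
    have "\<forall>t\<in>T. \<exists>v\<in>K t. support_fun (K t) (w t) = w t \<bullet> v"
    proof
      fix t assume t: "t \<in> T"
      from support_fun_max[OF K(2)[OF t] K(1)[OF t]]
      show "\<exists>v\<in>K t. support_fun (K t) (w t) = w t \<bullet> v" by blast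
    qed
    then obtain y where y: "\<forall>t\<in>T. y t \<in> K t \<and> support_fun (K t) (w t) = w t \<bullet> y t"
      by metis
    have "G (f e) \<in> H" unfolding H_def using e(1) by (intro hull_inc) auto
    moreover have "G y \<in> P" using y by (simp add: P_def G_nth)
    ultimately have "a \<bullet> G (f e) < a \<bullet> G y" using a by fastforce
    moreover have "a \<bullet> G y = - (\<Sum>t\<in>T. support_fun (K t) (w t))"
      using y by (simp add: G_inner w_def sum_negf)
    moreover have "a \<bullet> G (f e) = - (\<Sum>t\<in>T. w t \<bullet> f e t)"
      by (simp add: G_inner w_def sum_negf)
    ultimately show False using e(2) by linarith
  qed
  then obtain x where x: "x \<in> H" "x \<in> P" by blast
  obtain \<nu> where \<nu>: "set_pmf \<nu> \<subseteq> S" "measure_pmf.expectation \<nu> (\<lambda>e. G (f e)) = x"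
    using convex_hull_imp_expectation[OF S x(1)[unfolded H_def]] .
  have "measure_pmf.expectation \<nu> (\<lambda>e. f e t) \<in> K t" if t: "t \<in> T" for t
  proof -
    have "measure_pmf.expectation \<nu> (\<lambda>e. f e t) = (\<Sum>e\<in>S. pmf \<nu> e *\<^sub>R f e t)"
      using \<nu>(1) by (intro integral_measure_pmf[OF S]) auto
    also have "\<dots> = (\<Sum>e\<in>S. pmf \<nu> e *\<^sub>R G (f e)) $ g t"
      using t by (simp add: G_nth)
    also have "(\<Sum>e\<in>S. pmf \<nu> e *\<^sub>R G (f e)) = measure_pmf.expectation \<nu> (\<lambda>e. G (f e))"
      using \<nu>(1) by (intro integral_measure_pmf[OF S, symmetric]) auto
    finally show ?thesis using x(2) t \<nu>(2) by (simp add: P_def)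
  qed
  with \<nu>(1) show ?thesis by blast
qed

section \<open>A Kraft inequality for words with a revealed alphabet\<close>

definition prefix_freq :: "'b list set \<Rightarrow> 'b list \<Rightarrow> nat \<Rightarrow> nat"
  where "prefix_freq W x j = card {y \<in> W. take j y = take j x}"

text \<open>
  For a word drawn uniformly from \<open>W\<close> and revealed from left to right, this is the product of the
  conditional probabilities of those letters of \<open>x\<close> that lie outside \<open>B\<close>; letters in \<open>B\<close> are regarded
  as known in advance and contribute the factor 1.
\<close>

definition unrevealed_prob :: "'b list set \<Rightarrow> 'b set \<Rightarrow> 'b list \<Rightarrow> real"
  where "unrevealed_prob W B x = (\<Prod>j<length x. if x ! j \<in> B then 1
    else real (prefix_freq W x (Suc j)) / real (prefix_freq W x j))"

lemma unrevealed_prob_nonneg: "unrevealed_prob W B x \<ge> 0"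
  unfolding unrevealed_prob_def by (intro prod_nonneg) auto

text \<open>
  Conditioning on the first letter replaces \<open>W\<close> by the set of the tails of its words with that first letter.
\<close>

lemma unrevealed_prob_Cons:
  "unrevealed_prob W B (a # x) = (if a \<in> B then 1 else real (card {y. a # y \<in> W}) / real (card W)) *
    unrevealed_prob {y. a # y \<in> W} B x"
proof -
  have freq_Suc: "prefix_freq W (a # x) (Suc j) = prefix_freq {y. a # y \<in> W} x j" for j
  proof -
    have split: "take (Suc j) y = a # take j x \<longleftrightarrow> (\<exists>z. y = a # z \<and> take j z = take j x)" for y
      by (cases y) auto
    have "{y \<in> W. take (Suc j) y = take (Suc j) (a # x)} =
        (#) a ` {y \<in> {y. a # y \<in> W}. take j y = take j x}"
      unfolding take_Suc_Cons split by auto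
    then show ?thesis unfolding prefix_freq_def by (simp add: card_image)
  qed
  have "prefix_freq W (a # x) 0 = card W" "prefix_freq {y. a # y \<in> W} x 0 = card {y. a # y \<in> W}"
    by (simp_all add: prefix_freq_def)
  then show ?thesis
    unfolding unrevealed_prob_def
    by (simp only: list.size(4) add_Suc_right add_0_right prod.lessThan_Suc_shift freq_Suc
        nth_Cons_0 nth_Cons_Suc comp_def One_nat_def plus_1_eq_Suc)
qed

text \<open>
  Fix which positions carry a letter of \<open>B\<close> (the list \<open>bs\<close>) and the sequence \<open>ds\<close> of these letters, and
  build a word from left to right. At a position of \<open>B\<close> the next letter is forced, so a factor 1 costs
  nothing; at any other position the factors are the conditional probabilities of the possible letters,
  which sum to at most 1. Hence the total over all words with the pattern \<open>(bs, ds)\<close> stays at most 1.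
\<close>

lemma kraft_revealed:
  assumes "finite W"
  shows "(\<Sum>x | x \<in> W \<and> map (\<lambda>i. i \<in> B) x = bs \<and> filter (\<lambda>i. i \<in> B) x = ds. unrevealed_prob W B x) \<le> 1"
  using assms
proof (induction bs arbitrary: W ds)
  case Nil
  have "(\<Sum>x | x \<in> W \<and> map (\<lambda>i. i \<in> B) x = [] \<and> filter (\<lambda>i. i \<in> B) x = ds. unrevealed_prob W B x)
    \<le> (\<Sum>x\<in>{[]}. unrevealed_prob W B x)"
    by (intro sum_mono2) (auto simp: unrevealed_prob_nonneg)
  then show ?case by (simp add: unrevealed_prob_def)
next
  case (Cons b bs)
  define S where "S W bs ds = {x. x \<in> W \<and> map (\<lambda>i. i \<in> B) x = bs \<and> filter (\<lambda>i. i \<in> B) x = ds}"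
    for W bs ds
  define tails where "tails a = {y. a # y \<in> W}" for a
  have fin_tails: "finite (tails a)" for a
    unfolding tails_def using Cons.prems finite_vimageI[of W "(#) a"] by (simp add: vimage_def)
  have IH: "(\<Sum>y\<in>S (tails a) bs ds'. unrevealed_prob (tails a) B y) \<le> 1" for a ds'
    unfolding S_def by (rule Cons.IH[OF fin_tails])
  have "sum (unrevealed_prob W B) (S W (b # bs) ds) \<le> 1"
  proof (cases b)
    case True
    show ?thesis
    proof (cases "S W (b # bs) ds = {}")
      case True
      then show ?thesis by simp
    next
      case False
      \<comment> \<open>The first letter is in \<open>B\<close>, hence it is the head of \<open>ds\<close>.\<close>
      with \<open>b\<close> obtain d ds' where d: "ds = d # ds'" "d \<in> B"
        by (auto simp: S_def map_eq_Cons_conv)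
      have "S W (b # bs) ds = (#) d ` S (tails d) bs ds'"
        using \<open>b\<close> d by (auto simp: S_def tails_def map_eq_Cons_conv)
      then have "sum (unrevealed_prob W B) (S W (b # bs) ds)
          = (\<Sum>y\<in>S (tails d) bs ds'. unrevealed_prob W B (d # y))"
        by (simp add: sum.reindex)
      also have "\<dots> = (\<Sum>y\<in>S (tails d) bs ds'. unrevealed_prob (tails d) B y)"
        using d by (simp add: unrevealed_prob_Cons tails_def)
      finally show ?thesis using IH by simp
    qed
  next
    case False
    \<comment> \<open>The first letter is not in \<open>B\<close>, hence free: split the words according to it.\<close>
    define F where "F = hd ` S W (b # bs) ds"
    have "finite (S W (b # bs) ds)" using Cons.prems by (auto simp: S_def)
    then have "finite F" by (simp add: F_def)
    have not_B: "a \<notin> B" if "a \<in> F" for a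
      using that False by (auto simp: F_def S_def map_eq_Cons_conv)
    have fibre: "{x \<in> S W (b # bs) ds. hd x = a} = (#) a ` S (tails a) bs ds" if "a \<in> F" for a
      using False not_B[OF that] by (auto simp: S_def tails_def map_eq_Cons_conv)
    have "sum (unrevealed_prob W B) (S W (b # bs) ds)
        = (\<Sum>a\<in>F. sum (unrevealed_prob W B) {x \<in> S W (b # bs) ds. hd x = a})"
      unfolding F_def by (rule sum.image_gen) fact
    also have "\<dots> = (\<Sum>a\<in>F. \<Sum>y\<in>S (tails a) bs ds. unrevealed_prob W B (a # y))"
      by (rule sum.cong[OF refl], subst fibre, assumption, subst sum.reindex) auto
    also have "\<dots> = (\<Sum>a\<in>F. real (card (tails a)) / real (card W) *
        (\<Sum>y\<in>S (tails a) bs ds. unrevealed_prob (tails a) B y))"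
      by (intro sum.cong refl) (simp add: not_B unrevealed_prob_Cons tails_def sum_distrib_left)
    also have "\<dots> \<le> (\<Sum>a\<in>F. real (card (tails a)) / real (card W) * 1)"
      by (intro sum_mono mult_left_mono IH) auto
    also have "\<dots> = real (\<Sum>a\<in>F. card (tails a)) / real (card W)"
      by (simp add: sum_divide_distrib)
    also have "(\<Sum>a\<in>F. card (tails a)) = card (\<Union>a\<in>F. (#) a ` tails a)"
      using \<open>finite F\<close> fin_tails by (subst card_UN_disjoint) (auto simp: card_image)
    also have "real \<dots> / real (card W) \<le> 1"
    proof -
      have "card (\<Union>a\<in>F. (#) a ` tails a) \<le> card W"
        using Cons.prems by (intro card_mono) (auto simp: tails_def)
      then show ?thesis by (simp add: divide_le_eq)
    qed
    finally show ?thesis .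
  qed
  then show ?case by (simp add: S_def)
qed

text \<open>
  The words are increasing, so their letters in \<open>B\<close> are determined by a subset of \<open>B\<close>; together with the
  positions of these letters this leaves at most \<open>2 ^ k * 2 ^ card B\<close> patterns.
\<close>

lemma kraft_sorted_words:
  fixes B :: "'b::linorder set"
  assumes "finite W" and "finite B"
    and W: "\<And>x. x \<in> W \<Longrightarrow> length x = k \<and> sorted x \<and> distinct x"
  shows "(\<Sum>x\<in>W. unrevealed_prob W B x) \<le> 2 ^ k * 2 ^ card B"
proof -
  define key where "key x = (map (\<lambda>i. i \<in> B) x, filter (\<lambda>i. i \<in> B) x)" for x
  define Q where "Q = {bs :: bool list. length bs = k} \<times> sorted_list_of_set ` Pow B"
  have fin_bs: "finite {bs :: bool list. length bs = k}"
    using finite_lists_length_eq[of "UNIV :: bool set" k] by simp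
  then have "finite Q" using \<open>finite B\<close> by (simp add: Q_def)
  have "filter (\<lambda>i. i \<in> B) x \<in> sorted_list_of_set ` Pow B" if "x \<in> W" for x
  proof -
    have "filter (\<lambda>i. i \<in> B) x = sorted_list_of_set (set (filter (\<lambda>i. i \<in> B) x))"
      using W[OF that] by (intro sorted_list_of_set.idem_if_sorted_distinct[symmetric]) (auto simp: sorted_wrt_filter)
    then show ?thesis by auto
  qed
  then have "key ` W \<subseteq> Q" using W by (auto simp: key_def Q_def)
  then have "(\<Sum>x\<in>W. unrevealed_prob W B x) = (\<Sum>q\<in>Q. sum (unrevealed_prob W B) {x \<in> W. key x = q})"
    using sum.group[OF \<open>finite W\<close> \<open>finite Q\<close>, of key "unrevealed_prob W B"] by simp
  also have "\<dots> \<le> (\<Sum>q\<in>Q. 1)"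
    using kraft_revealed[OF \<open>finite W\<close>, of B] by (intro sum_mono) (auto simp: key_def)
  also have "\<dots> = real (card {bs :: bool list. length bs = k} * card (sorted_list_of_set ` Pow B))"
    by (simp add: Q_def card_cartesian_product)
  also have "\<dots> \<le> real (2 ^ k * 2 ^ card B)"
  proof (intro of_nat_mono mult_mono)
    show "card {bs :: bool list. length bs = k} \<le> 2 ^ k"
      using card_lists_length_eq[of "UNIV :: bool set" k] by simp
    show "card (sorted_list_of_set ` Pow B) \<le> 2 ^ card B"
      using card_image_le[of "Pow B" sorted_list_of_set] \<open>finite B\<close> by (simp add: card_Pow)
  qed auto
  finally show ?thesis by simp
qed

section \<open>The vectors of an encoder\<close>

lemma inj_on_word:
  fixes C :: "'a \<Rightarrow> 'd::{finite,linorder} set"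
  assumes "inj_on C T"
  shows "inj_on (\<lambda>t. word (C t)) T"
proof (rule inj_onI)
  fix s t assume st: "s \<in> T" "t \<in> T" "word (C s) = word (C t)"
  have set_word: "set (word X) = X" for X :: "'d set" by (simp add: word_def)
  from arg_cong[OF st(3), of set] have "C s = C t" unfolding set_word .
  from inj_onD[OF assms this st(1,2)] show "s = t" .
qed

lemma prefix_count_pos:
  assumes "finite T" "t \<in> T"
  shows "prefix_count T C t j > 0"
  using assms unfolding prefix_count_def by (subst card_gt_0_iff) auto

lemma prefix_count_antimono:
  assumes "finite T" "i \<le> j"
  shows "prefix_count T C t j \<le> prefix_count T C t i"
  unfolding prefix_count_def
proof (intro card_mono)
  show "{t' \<in> T. card (C t') = card (C t) \<and> take j (word (C t')) = take j (word (C t))}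
    \<subseteq> {t' \<in> T. card (C t') = card (C t) \<and> take i (word (C t')) = take i (word (C t))}"
  proof -
    have "take i x = take i y" if "take j x = take j y" for x y :: "'b list"
      using arg_cong[OF that, of "take i"] assms(2) by (simp add: min_absorb1)
    then show ?thesis by blast
  qed
qed (use assms in auto)

lemma mass_tau:
  "mass (tau T C t) D = (\<Sum>j<card (C t). if word (C t) ! j \<in> D
    then ln (real (prefix_count T C t j) / real (prefix_count T C t (Suc j))) else 0)"
proof -
  define l where "l j = ln (real (prefix_count T C t j) / real (prefix_count T C t (Suc j)))" for j
  have "tau T C t = (\<Sum>j<card (C t). axis (word (C t) ! j) (l j))"
    unfolding tau_def l_def by (rule sum.reindex_bij_witness[of _ Suc "\<lambda>j. j - 1"]) auto
  then have "mass (tau T C t) D = (\<Sum>i\<in>D. \<Sum>j<card (C t). if word (C t) ! j = i then l j else 0)"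
    by (auto simp: mass_def axis_def intro!: sum.cong)
  also have "\<dots> = (\<Sum>j<card (C t). \<Sum>i\<in>D. if word (C t) ! j = i then l j else 0)"
    by (rule sum.swap)
  also have "\<dots> = (\<Sum>j<card (C t). if word (C t) ! j \<in> D then l j else 0)" by simp
  finally show ?thesis by (simp only: l_def)
qed

lemma tau_nonneg:
  assumes "finite T" "t \<in> T"
  shows "tau T C t $ i \<ge> 0"
proof -
  have "ln (real (prefix_count T C t j) / real (prefix_count T C t (Suc j))) \<ge> 0" for j
    using prefix_count_pos[OF assms, of C "Suc j"] prefix_count_antimono[OF assms(1), of j "Suc j" C t]
    by simp
  then have "mass (tau T C t) {i} \<ge> 0"
    unfolding mass_tau by (intro sum_nonneg) simp
  then show ?thesis by (simp add: mass_def)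
qed

text \<open>
  The logarithms telescope to $\log n_0-\log n_k$, where $n_0\le|T|$ and $n_k\ge1$.
\<close>

lemma mass_tau_UNIV_le:
  assumes "finite T" "t \<in> T"
  shows "mass (tau T C t) UNIV \<le> ln (real (card T))"
proof -
  let ?n = "prefix_count T C t"
  have pos: "?n j > 0" for j using assms by (rule prefix_count_pos)
  have "mass (tau T C t) UNIV = (\<Sum>j<card (C t). ln (real (?n j)) - ln (real (?n (Suc j))))"
    using pos by (simp add: mass_tau ln_div)
  also have "\<dots> = ln (real (?n 0)) - ln (real (?n (card (C t))))"
    by (rule sum_lessThan_telescope')
  also have "\<dots> \<le> ln (real (?n 0))"
    using pos[of "card (C t)"] by simp
  also have "\<dots> \<le> ln (real (card T))"
  proof -
    have "?n 0 \<le> card T" unfolding prefix_count_def using assms by (intro card_mono) auto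
    then show ?thesis using pos[of 0] by simp
  qed
  finally show ?thesis .
qed

text \<open>
  All letters of the word of \<open>t\<close> lie in \<open>D\<close>, so those counted by the mass on \<open>D - B\<close> are exactly the
  letters outside \<open>B\<close>.
\<close>

lemma exp_neg_mass_tau:
  assumes "finite T" "t \<in> T" "inj_on C T" "C t \<subseteq> D"
  shows "exp (- mass (tau T C t) (D - B)) =
    unrevealed_prob ((\<lambda>s. word (C s)) ` {s \<in> T. card (C s) = card (C t)}) B (word (C t))"
proof -
  let ?W = "(\<lambda>s. word (C s)) ` {s \<in> T. card (C s) = card (C t)}"
  have inj: "inj_on (\<lambda>s. word (C s)) X" if "X \<subseteq> T" for X
    using inj_on_word[OF assms(3)] that by (rule inj_on_subset)
  have freq: "prefix_count T C t j = prefix_freq ?W (word (C t)) j" for j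
  proof -
    have "{y \<in> ?W. take j y = take j (word (C t))} = (\<lambda>s. word (C s)) `
      {s \<in> T. card (C s) = card (C t) \<and> take j (word (C s)) = take j (word (C t))}" by auto
    then show ?thesis
      unfolding prefix_count_def prefix_freq_def by (simp add: card_image inj)
  qed
  have letters: "word (C t) ! j \<in> D" if "j < card (C t)" for j
    using that assms(4) nth_mem[of j "word (C t)"] by (auto simp: word_def)
  have "exp (- mass (tau T C t) (D - B)) = (\<Prod>j<card (C t). exp (- (if word (C t) ! j \<in> D - B
    then ln (real (prefix_count T C t j) / real (prefix_count T C t (Suc j))) else 0)))"
    by (simp add: mass_tau exp_sum sum_negf[symmetric] del: Diff_iff)
  also have "\<dots> = unrevealed_prob ?W B (word (C t))"
    unfolding unrevealed_prob_def freq[symmetric]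
    using letters prefix_count_pos[OF assms(1,2), of C]
    by (intro prod.cong) (auto simp: word_def exp_minus)
  finally show ?thesis .
qed

text \<open>
  The labels are grouped by the length \<open>k \<le> m\<close> of their words; each of the \<open>m + 1\<close> groups contributes at
  most \<open>2 ^ k * 2 ^ card B \<le> 4 ^ m\<close>.
\<close>

lemma kraft_encoder:
  fixes A :: "'a \<Rightarrow> 'd::{finite,linorder} set"
  assumes "finite T" "inj_on C T"
    and A: "\<And>t. t \<in> T \<Longrightarrow> C t \<subseteq> A t" "\<And>t. t \<in> T \<Longrightarrow> card (A t) \<le> m" and B: "card B \<le> m"
  shows "(\<Sum>t\<in>T. exp (- mass (tau T C t) (A t - B))) \<le> (real m + 1) * 4 ^ m"
proof -
  define L where "L k = {s \<in> T. card (C s) = k}" for k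
  define W where "W k = (\<lambda>s. word (C s)) ` L k" for k
  have "card (C t) \<le> m" if "t \<in> T" for t
    using A[OF that] card_mono[of "A t" "C t"] by simp
  then have "(\<Sum>t\<in>T. exp (- mass (tau T C t) (A t - B))) =
      (\<Sum>k\<le>m. \<Sum>t\<in>L k. exp (- mass (tau T C t) (A t - B)))"
    unfolding L_def using \<open>finite T\<close> by (intro sum.group[symmetric]) auto
  also have "\<dots> \<le> (\<Sum>k\<le>m. 4 ^ m)"
  proof (intro sum_mono)
    fix k assume k: "k \<in> {..m}"
    have inj: "inj_on (\<lambda>s. word (C s)) (L k)"
      by (rule inj_on_subset[OF inj_on_word[OF assms(2)]]) (auto simp: L_def)
    have "(\<Sum>t\<in>L k. exp (- mass (tau T C t) (A t - B))) = (\<Sum>t\<in>L k. unrevealed_prob (W k) B (word (C t)))"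
      using assms(1,2) A(1) by (intro sum.cong refl) (auto simp: exp_neg_mass_tau W_def L_def)
    also have "\<dots> = (\<Sum>x\<in>W k. unrevealed_prob (W k) B x)"
      unfolding W_def using inj by (simp add: sum.reindex)
    also have "\<dots> \<le> 2 ^ k * 2 ^ card B"
      using \<open>finite T\<close> by (intro kraft_sorted_words) (auto simp: W_def L_def word_def)
    also have "\<dots> \<le> 2 ^ m * 2 ^ m"
      using k B by (intro mult_mono power_increasing) auto
    finally show "(\<Sum>t\<in>L k. exp (- mass (tau T C t) (A t - B))) \<le> 4 ^ m"
      by (simp add: power_mult_distrib[symmetric])
  qed
  finally show ?thesis by (simp add: add.commute)
qed

section \<open>Averaged encoders and an independent set\<close>

lemma exp_neg_expectation_le:
  fixes h :: "'e \<Rightarrow> real"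
  assumes "finite S" "set_pmf \<nu> \<subseteq> S"
  shows "exp (- measure_pmf.expectation \<nu> h) \<le> (\<Sum>e\<in>S. pmf \<nu> e * exp (- h e))"
proof -
  have "measure_pmf.expectation \<nu> h = (\<Sum>e\<in>S. pmf \<nu> e *\<^sub>R h e)"
    using assms by (intro integral_measure_pmf) auto
  moreover have "exp (\<Sum>e\<in>S. pmf \<nu> e *\<^sub>R (- h e)) \<le> (\<Sum>e\<in>S. pmf \<nu> e * exp (- h e))"
    using assms set_pmf_not_empty[of \<nu>] by (intro convex_on_sum[OF _ _ exp_convex]) (auto simp: sum_pmf_eq_1)
  ultimately show ?thesis by (simp add: sum_negf)
qed

text \<open>
  The sum of all outdegrees is the sum of all indegrees, so some vertex has total degree at most
  \<open>2 * \<delta>\<close>. Select it, delete it with its at most \<open>2 * \<delta>\<close> neighbours, and continue: unlike a bound on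
  the average degree, the bound on the indegrees is inherited by subsets.
\<close>

lemma independent_set_of_bounded_indegree:
  fixes \<delta> :: real
  assumes "finite T" and "\<And>s. s \<in> T \<Longrightarrow> real (card {t \<in> T. R t s}) \<le> \<delta>"
  shows "\<exists>I\<subseteq>T. real (card T) \<le> (1 + 2 * \<delta>) * real (card I) \<and> (\<forall>t\<in>I. \<forall>s\<in>I. t \<noteq> s \<longrightarrow> \<not> R t s)"
  using assms
proof (induction T rule: finite_psubset_induct)
  case (psubset T)
  show ?case
  proof (cases "T = {}")
    case True
    then show ?thesis by auto
  next
    case False
    define deg where "deg v = card {t \<in> T. R t v} + card {s \<in> T. R v s}" for v
    have double_count: "(\<Sum>v\<in>T. card {s \<in> T. R v s}) = (\<Sum>s\<in>T. card {v \<in> T. R v s})"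
      using sum.swap_restrict[OF \<open>finite T\<close> \<open>finite T\<close>, of "\<lambda>_ _. 1::nat" R] by simp
    have "\<exists>v\<in>T. real (deg v) \<le> 2 * \<delta>"
    proof (rule ccontr)
      assume "\<not> ?thesis"
      then have "(\<Sum>v\<in>T. 2 * \<delta>) < (\<Sum>v\<in>T. real (deg v))"
        using False \<open>finite T\<close> by (intro sum_strict_mono) auto
      also have "\<dots> = 2 * (\<Sum>s\<in>T. real (card {v \<in> T. R v s}))"
        unfolding deg_def using double_count by (simp add: sum.distrib flip: of_nat_sum)
      also have "\<dots> \<le> 2 * (\<Sum>s\<in>T. \<delta>)"
        using psubset.prems by (intro mult_left_mono sum_mono) auto
      finally show False by simp
    qed
    then obtain v where v: "v \<in> T" "real (deg v) \<le> 2 * \<delta>" by blast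
    define N where "N = insert v ({t \<in> T. R t v} \<union> {s \<in> T. R v s})"
    have "card N \<le> Suc (deg v)"
      unfolding N_def deg_def using \<open>finite T\<close>
      using card_Un_le[of "{t \<in> T. R t v}" "{s \<in> T. R v s}"] by (auto simp: card_insert_if)
    have "N \<subseteq> T" "v \<in> N" using v by (auto simp: N_def)
    have "T - N \<subset> T" using v \<open>v \<in> N\<close> by auto
    have "real (card {t \<in> T - N. R t s}) \<le> \<delta>" if "s \<in> T - N" for s
    proof -
      have "card {t \<in> T - N. R t s} \<le> card {t \<in> T. R t s}"
        using \<open>finite T\<close> by (intro card_mono) auto
      then show ?thesis using psubset.prems[of s] that by force
    qed
    from psubset.IH[OF \<open>T - N \<subset> T\<close> this] obtain I where
      I: "I \<subseteq> T - N" "real (card (T - N)) \<le> (1 + 2 * \<delta>) * real (card I)"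
        "\<forall>t\<in>I. \<forall>s\<in>I. t \<noteq> s \<longrightarrow> \<not> R t s" by blast
    have "finite I" "v \<notin> I" using I(1) \<open>finite T\<close> \<open>v \<in> N\<close> by (auto intro: finite_subset)
    have "real (card T) = real (card N) + real (card (T - N))"
      using \<open>N \<subseteq> T\<close> \<open>finite T\<close> card_mono[of T N] finite_subset[of N T] by (simp add: card_Diff_subset)
    also have "\<dots> \<le> (1 + 2 * \<delta>) + (1 + 2 * \<delta>) * real (card I)"
      using \<open>card N \<le> Suc (deg v)\<close> v(2) I(2) by linarith
    also have "\<dots> = (1 + 2 * \<delta>) * real (card (insert v I))"
      using \<open>finite I\<close> \<open>v \<notin> I\<close> by (simp add: algebra_simps)
    finally have "real (card T) \<le> (1 + 2 * \<delta>) * real (card (insert v I))" .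
    moreover have "insert v I \<subseteq> T" using I(1) v(1) by auto
    moreover have "\<forall>t\<in>insert v I. \<forall>s\<in>insert v I. t \<noteq> s \<longrightarrow> \<not> R t s"
      using I(1,3) by (auto simp: N_def)
    ultimately show ?thesis by blast
  qed
qed

text \<open>
  A Markov-type estimate: each label that is counted contributes more than \<open>exp (- r)\<close> to the sum of
  the exponentials of the negative masses, and by Jensen's inequality the bound of \<open>kraft_encoder\<close>
  for individual encoders passes to the averaged vectors.
\<close>

lemma few_labels_with_little_mass:
  fixes A :: "'a \<Rightarrow> 'd::{finite,linorder} set"
  assumes "finite T" and \<nu>: "set_pmf \<nu> \<subseteq> encoders T A"
    and A: "\<And>t. t \<in> T \<Longrightarrow> card (A t) \<le> m" and B: "card B \<le> m"
  shows "real (card {t \<in> T. mass (measure_pmf.expectation \<nu> (\<lambda>C. tau T C t)) (A t - B) < r})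
    \<le> (real m + 1) * 4 ^ m * exp r"
proof -
  let ?S = "encoders T A"
  let ?b = "\<lambda>t. mass (measure_pmf.expectation \<nu> (\<lambda>C. tau T C t)) (A t - B)"
  let ?L = "{t \<in> T. ?b t < r}"
  have finS: "finite ?S" using \<open>finite T\<close> by (rule finite_encoders)
  have b: "?b t = measure_pmf.expectation \<nu> (\<lambda>C. mass (tau T C t) (A t - B))" for t
  proof -
    have "measure_pmf.expectation \<nu> (\<lambda>C. tau T C t) = (\<Sum>C\<in>?S. pmf \<nu> C *\<^sub>R tau T C t)"
      using \<nu> by (intro integral_measure_pmf[OF finS]) auto
    then have "?b t = (\<Sum>i\<in>A t - B. \<Sum>C\<in>?S. pmf \<nu> C * tau T C t $ i)" by (simp add: mass_def)
    also have "\<dots> = (\<Sum>C\<in>?S. \<Sum>i\<in>A t - B. pmf \<nu> C * tau T C t $ i)" by (rule sum.swap)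
    also have "\<dots> = (\<Sum>C\<in>?S. pmf \<nu> C *\<^sub>R mass (tau T C t) (A t - B))"
      by (simp add: mass_def sum_distrib_left)
    also have "\<dots> = measure_pmf.expectation \<nu> (\<lambda>C. mass (tau T C t) (A t - B))"
      using \<nu> by (intro integral_measure_pmf[OF finS, symmetric]) auto
    finally show ?thesis .
  qed
  have "real (card ?L) * exp (- r) = (\<Sum>t\<in>?L. exp (- r))" by simp
  also have "\<dots> \<le> (\<Sum>t\<in>?L. exp (- ?b t))" by (intro sum_mono) auto
  also have "\<dots> \<le> (\<Sum>t\<in>T. exp (- ?b t))" using \<open>finite T\<close> by (intro sum_mono2) auto
  also have "\<dots> \<le> (\<Sum>t\<in>T. \<Sum>C\<in>?S. pmf \<nu> C * exp (- mass (tau T C t) (A t - B)))"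
    unfolding b by (intro sum_mono exp_neg_expectation_le[OF finS \<nu>])
  also have "\<dots> = (\<Sum>C\<in>?S. pmf \<nu> C * (\<Sum>t\<in>T. exp (- mass (tau T C t) (A t - B))))"
    by (subst sum.swap) (simp add: sum_distrib_left)
  also have "\<dots> \<le> (\<Sum>C\<in>?S. pmf \<nu> C * ((real m + 1) * 4 ^ m))"
    using assms by (intro sum_mono mult_left_mono kraft_encoder) (auto simp: encoders_def)
  also have "\<dots> = (real m + 1) * 4 ^ m"
    using sum_pmf_eq_1[OF finS \<nu>] by (simp flip: sum_distrib_right)
  finally have "real (card ?L) * exp (- r) * exp r \<le> (real m + 1) * 4 ^ m * exp r"
    by (intro mult_right_mono) auto
  then show ?thesis by (simp add: mult.assoc flip: exp_add)
qed

section \<open>Threshold encoders\<close>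

lemma inner_le_support_fun:
  fixes K :: "(real^'d::finite) set"
  assumes "compact K" "v \<in> K"
  shows "w \<bullet> v \<le> support_fun K w"
  using support_fun_max[of K w] assms by force

lemma support_fun_nonneg:
  fixes K :: "(real^'d::finite) set"
  assumes K: "compact K" "K \<noteq> {}" "downward_closed K" "\<And>v. v \<in> K \<Longrightarrow> 0 \<le> v"
  shows "support_fun K w \<ge> 0"
proof -
  obtain v where v: "v \<in> K" using K(2) by blast
  have "0 \<le> (0::real^'d) \<and> 0 \<le> v" using K(4)[OF v] by simp
  then have "0 \<in> K" using K(3) v unfolding downward_closed_def by blast
  then show ?thesis using inner_le_support_fun[OF K(1), of 0 w] by simp
qed

text \<open>
  Let $h=h_K(w)$ and suppose that some $v\in K$ had $v(D)\ge u$. Its restriction $z$ to $D$ lies in $K$ by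
  downward closedness, and $\langle w,z\rangle>\frac hu\,v(D)\ge h$ because $w>h/u$ on $D$; this
  contradicts the definition of $h$.
\<close>

lemma support_fun_indvec_less_of_threshold:
  fixes K :: "(real^'d::finite) set"
  assumes K: "compact K" "K \<noteq> {}" "downward_closed K" "\<And>v. v \<in> K \<Longrightarrow> 0 \<le> v" and "u > 0"
    and above: "\<And>i. i \<in> D \<Longrightarrow> w $ i > support_fun K w / u"
  shows "support_fun K (indvec D) < u"
proof (rule ccontr)
  assume "\<not> ?thesis"
  moreover obtain v where v: "v \<in> K" "support_fun K (indvec D) = indvec D \<bullet> v"
    using support_fun_max[OF K(1,2)] by blast
  moreover have "indvec D \<bullet> v = mass v D"
    by (simp add: indvec_def mass_def inner_vec_def indicator_def if_distrib[of "\<lambda>x. x * _"] sum.If_cases)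
  ultimately have heavy: "mass v D \<ge> u" by simp
  have v_nonneg: "v $ i \<ge> 0" for i using K(4)[OF v(1)] by (simp add: less_eq_vec_def)
  define z where "z = (\<chi> i. if i \<in> D then v $ i else 0)"
  have "z \<in> K"
    using K(3) v(1) v_nonneg unfolding downward_closed_def z_def by (auto simp: less_eq_vec_def)
  have "\<exists>i\<in>D. v $ i > 0"
  proof (rule ccontr)
    assume "\<not> ?thesis"
    then have "mass v D \<le> 0" unfolding mass_def by (intro sum_nonpos) (auto simp: not_less)
    then show False using heavy \<open>u > 0\<close> by simp
  qed
  then obtain k where k: "k \<in> D" "v $ k > 0" by blast
  have "support_fun K w \<ge> 0" using K by (rule support_fun_nonneg)
  then have "support_fun K w \<le> support_fun K w / u * mass v D"
    using heavy \<open>u > 0\<close> mult_left_mono[of u "mass v D" "support_fun K w"] by (simp add: field_simps)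
  also have "\<dots> = (\<Sum>i\<in>D. support_fun K w / u * v $ i)"
    by (simp add: mass_def sum_distrib_left)
  also have "\<dots> < (\<Sum>i\<in>D. w $ i * v $ i)"
    using k above v_nonneg
    by (intro sum_strict_mono_ex1 ballI bexI[of _ k] mult_right_mono mult_strict_right_mono) (auto intro: less_imp_le)
  also have "\<dots> = w \<bullet> z"
    by (simp add: inner_vec_def z_def if_distrib[of "\<lambda>x. _ * x"] sum.If_cases)
  also have "\<dots> \<le> support_fun K w" by (rule inner_le_support_fun[OF K(1) \<open>z \<in> K\<close>])
  finally show False by simp
qed

text \<open>
  The coordinates where $w_t$ is at most $h_{K_t}(w_t)/u$ are cheap, and only these enter $C_t$; the cost
  bound follows from the bound on the total mass of \<open>tau\<close>. If two labels had the same set, all of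
  $A_t\setminus A_s$ and of $A_s\setminus A_t$ would lie above the respective thresholds, and both support
  functions of these differences would be below \<open>u\<close>.
\<close>

lemma threshold_encoder:
  fixes A :: "'a \<Rightarrow> 'd::{finite,linorder} set" and w :: "'a \<Rightarrow> real^('d::{finite,linorder})"
  assumes "finite T"
    and K: "\<And>t. t \<in> T \<Longrightarrow> compact (K t)" "\<And>t. t \<in> T \<Longrightarrow> K t \<noteq> {}" "\<And>t. t \<in> T \<Longrightarrow> downward_closed (K t)"
      "\<And>t v. t \<in> T \<Longrightarrow> v \<in> K t \<Longrightarrow> 0 \<le> v"
    and "u > 0"
    and sep: "\<And>s t. s \<in> T \<Longrightarrow> t \<in> T \<Longrightarrow> s \<noteq> t \<Longrightarrow>
      max (support_fun (K t) (indvec (A t - A s))) (support_fun (K s) (indvec (A s - A t))) \<ge> u"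
  shows "\<exists>C\<in>encoders T A. \<forall>t\<in>T. w t \<bullet> tau T C t \<le> ln (real (card T)) / u * support_fun (K t) (w t)"
proof -
  define \<theta> where "\<theta> t = support_fun (K t) (w t) / u" for t
  define C where "C = (\<lambda>t\<in>T. {i \<in> A t. w t $ i \<le> \<theta> t})"
  have small: "support_fun (K t) (indvec (A t - A s)) < u" if "s \<in> T" "t \<in> T" "C s = C t" for s t
  proof (rule support_fun_indvec_less_of_threshold[of _ _ _ "w t"])
    fix i assume i: "i \<in> A t - A s"
    then have "i \<notin> C s" using that(1) by (simp add: C_def)
    then have "i \<notin> C t" using that(3) by simp
    then show "support_fun (K t) (w t) / u < w t $ i"
      using i that(2) by (simp add: C_def \<theta>_def not_le)
  qed (use K that \<open>u > 0\<close> in auto)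
  have "inj_on C T"
  proof (rule inj_onI, rule ccontr)
    fix s t assume st: "s \<in> T" "t \<in> T" "C s = C t" "s \<noteq> t"
    then show False using small[of s t] small[of t s] sep[of s t] by auto
  qed
  then have "C \<in> encoders T A" unfolding encoders_def C_def by auto
  moreover have "w t \<bullet> tau T C t \<le> ln (real (card T)) / u * support_fun (K t) (w t)" if t: "t \<in> T" for t
  proof -
    have "\<theta> t \<ge> 0"
      using support_fun_nonneg[OF K(1)[OF t] K(2)[OF t] K(3)[OF t] K(4)[OF t]] \<open>u > 0\<close>
      by (simp add: \<theta>_def)
    have "w t \<bullet> tau T C t = (\<Sum>i\<in>UNIV. w t $ i * tau T C t $ i)" by (simp add: inner_vec_def)
    also have "\<dots> \<le> (\<Sum>i\<in>UNIV. \<theta> t * tau T C t $ i)"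
    proof (rule sum_mono)
      fix i
      show "w t $ i * tau T C t $ i \<le> \<theta> t * tau T C t $ i"
      proof (cases "i \<in> C t")
        case True
        then show ?thesis
          using t tau_nonneg[OF \<open>finite T\<close> t] by (intro mult_right_mono) (auto simp: C_def)
      qed (simp add: tau_outside)
    qed
    also have "\<dots> = \<theta> t * mass (tau T C t) UNIV" by (simp add: mass_def sum_distrib_left)
    also have "\<dots> \<le> \<theta> t * ln (real (card T))"
      using \<open>\<theta> t \<ge> 0\<close> mass_tau_UNIV_le[OF \<open>finite T\<close> t] by (intro mult_left_mono)
    finally show ?thesis by (simp add: \<theta>_def mult.commute)
  qed
  ultimately show ?thesis by blast
qed

section \<open>The separated subfamily\<close>

text \<open>
  With $E=e^{p/4}$ the denominator is at most $4\cdot 8^nE\le 2^{5n}E\le e^{5n}E\le E^2=e^{p/2}$, as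
  $n+1\le2^n$ and $5n\le p/4$.
\<close>

lemma exp_half_le_of_small_alphabet:
  fixes p :: real
  assumes "n \<ge> 1" "64 * real n \<le> p"
  shows "exp (p / 2) \<le> exp p / (1 + 2 * ((real n + 1) * 4 ^ n * exp (p / 4)))"
proof -
  define E where "E = exp (p / 4)"
  have "E \<ge> 1" using assms by (simp add: E_def)
  have "real n + 1 \<le> 2 ^ n"
    using of_nat_mono[OF Suc_leI[OF less_exp[of n]], where ?'a = real] by simp
  then have "(real n + 1) * 4 ^ n \<le> 2 ^ n * 4 ^ n" by (intro mult_right_mono) auto
  also have "\<dots> = 8 ^ n" by (simp flip: power_mult_distrib)
  finally have "(real n + 1) * 4 ^ n * E \<le> 8 ^ n * E" using \<open>E \<ge> 1\<close> by (intro mult_right_mono) auto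
  moreover have "1 \<le> 8 ^ n * E"
    using \<open>E \<ge> 1\<close> mult_mono[of 1 "8 ^ n" 1 E] by (simp add: one_le_power)
  ultimately have "1 + 2 * ((real n + 1) * 4 ^ n * E) \<le> 2 ^ 2 * 8 ^ n * E" by simp
  also have "(2::real) ^ 2 * 8 ^ n = 2 ^ (2 + 3 * n)"
    by (simp add: power_add power_mult)
  also have "(2::real) ^ (2 + 3 * n) \<le> 2 ^ (5 * n)" using assms by (intro power_increasing) auto
  also have "(2::real) ^ (5 * n) \<le> exp 1 ^ (5 * n)"
    using exp_ge_add_one_self[of 1] by (intro power_mono) auto
  also have "\<dots> = exp (real (5 * n))" by (simp flip: exp_of_nat_mult)
  also have "\<dots> \<le> E" using assms by (simp add: E_def)
  finally have "1 + 2 * ((real n + 1) * 4 ^ n * E) \<le> E * E" using \<open>E \<ge> 1\<close> by simp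
  also have "E * E = exp (p / 2)" by (simp add: E_def flip: exp_add)
  finally have "exp (p / 2) * (1 + 2 * ((real n + 1) * 4 ^ n * E)) \<le> exp (p / 2) * exp (p / 2)"
    by (intro mult_left_mono) auto
  also have "\<dots> = exp p" by (simp flip: exp_add)
  finally have "exp (p / 2) * (1 + 2 * ((real n + 1) * 4 ^ n * E)) \<le> exp p" .
  moreover have "1 + 2 * ((real n + 1) * 4 ^ n * E) > 0"
    using \<open>E \<ge> 1\<close> by (intro add_pos_nonneg mult_nonneg_nonneg) auto
  ultimately show ?thesis by (simp only: E_def[symmetric] pos_le_divide_eq)
qed

theorem corollary4p3:
  fixes T :: "'a set"
    and A :: "'a \<Rightarrow> 'd::{finite,linorder} set"
    and K :: "'a \<Rightarrow> (real^('d::{finite,linorder})) set"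
    and m :: int
    and p u :: real
  assumes "finite T" and "card T \<ge> 2"
    and "p = ln (real (card T))"
    and "\<And>t. t \<in> T \<Longrightarrow> int (card (A t)) \<le> m"
    and "\<And>t. t \<in> T \<Longrightarrow> K t \<noteq> {}"
    and "\<And>t. t \<in> T \<Longrightarrow> compact (K t)"
    and "\<And>t. t \<in> T \<Longrightarrow> convex (K t)"
    and "\<And>t. t \<in> T \<Longrightarrow> downward_closed (K t)"
    and "\<And>t v. t \<in> T \<Longrightarrow> v \<in> K t \<Longrightarrow> 0 \<le> v"
    and "\<And>t v i. t \<in> T \<Longrightarrow> v \<in> K t \<Longrightarrow> i \<notin> A t \<Longrightarrow> v $ i = 0"
    and "u > 0"
    and "\<And>s t. s \<in> T \<Longrightarrow> t \<in> T \<Longrightarrow> s \<noteq> t \<Longrightarrow>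
      max (support_fun (K t) (indvec (A t - A s))) (support_fun (K s) (indvec (A s - A t))) \<ge> u"
  shows "\<exists>\<nu> :: ('a \<Rightarrow> 'd set) pmf. set_pmf \<nu> \<subseteq> encoders T A \<and>
    (let a = (\<lambda>t. (u / (2 * p)) *\<^sub>R measure_pmf.expectation \<nu> (\<lambda>C. tau T C t));
         B = (real_of_int m + 1) * 4 powi m
     in (\<forall>t\<in>T. a t \<in> K t) \<and>
        (\<exists>T'. T' \<subseteq> T \<and>
          real (card T') \<ge> exp p / (1 + 2 * B * exp (p / 4)) \<and>
          (\<forall>t\<in>T'. \<forall>s\<in>T'. t \<noteq> s \<longrightarrow> mass (a t) (A t - A s) \<ge> u / 8) \<and>
          (m \<ge> 1 \<and> real_of_int m \<le> p / 64 \<longrightarrow> real (card T') \<ge> exp (p / 2))))"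
proof -
  have p_pos: "p > 0" using assms(2,3) by simp
  have exp_p: "exp p = real (card T)" using assms(2,3) by simp
  obtain t0 where "t0 \<in> T" using assms(2) by fastforce
  then have "m \<ge> 0" using assms(4)[of t0] by linarith
  then obtain n where m: "m = int n" using nonneg_int_cases by blast
  have card_A: "card (A t) \<le> n" if "t \<in> T" for t using assms(4)[OF that] m by simp
  \<comment> \<open>If \<open>A s = A t\<close>, both support functions are taken at 0 and stay below \<open>u\<close>. So the sets \<open>A t\<close>, elements
    of a finite type, can serve as names of the labels.\<close>
  have "inj_on A T"
  proof (rule inj_onI, rule ccontr)
    fix s t assume st: "s \<in> T" "t \<in> T" "A s = A t" "s \<noteq> t"
    have "support_fun (K r) (indvec {}) < u" if r: "r \<in> T" for r
      by (rule support_fun_indvec_less_of_threshold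
          [OF assms(6)[OF r] assms(5)[OF r] assms(8)[OF r] assms(9)[OF r] assms(11)]) simp_all
    from this[OF st(1)] this[OF st(2)] show False
      using assms(12)[OF st(1,2,4)] st(3) by simp
  qed
  have no_sep: "\<exists>C\<in>encoders T A. (\<Sum>t\<in>T. w t \<bullet> ((u / (2 * p)) *\<^sub>R tau T C t))
      \<le> (\<Sum>t\<in>T. support_fun (K t) (w t))" for w
  proof -
    have "\<exists>C\<in>encoders T A. \<forall>t\<in>T. w t \<bullet> tau T C t \<le> ln (real (card T)) / u * support_fun (K t) (w t)"
      by (rule threshold_encoder) (fact assms)+
    then obtain C where C: "C \<in> encoders T A"
        "\<forall>t\<in>T. w t \<bullet> tau T C t \<le> ln (real (card T)) / u * support_fun (K t) (w t)" by blast
    have "w t \<bullet> ((u / (2 * p)) *\<^sub>R tau T C t) \<le> support_fun (K t) (w t)" if t: "t \<in> T" for t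
    proof -
      have "support_fun (K t) (w t) \<ge> 0"
        by (rule support_fun_nonneg[OF assms(6)[OF t] assms(5)[OF t] assms(8)[OF t] assms(9)[OF t]])
      moreover have "w t \<bullet> tau T C t \<le> p / u * support_fun (K t) (w t)"
        using C(2) t assms(3) by simp
      then have "u / (2 * p) * (w t \<bullet> tau T C t) \<le> u / (2 * p) * (p / u * support_fun (K t) (w t))"
        using p_pos assms(11) by (intro mult_left_mono) auto
      moreover have "u / (2 * p) * (p / u * support_fun (K t) (w t)) = support_fun (K t) (w t) / 2"
        using p_pos assms(11) by simp
      ultimately show ?thesis by simp
    qed
    then show ?thesis using C(1) by (intro bexI[of _ C] sum_mono)
  qed
  have "\<exists>\<nu>. set_pmf \<nu> \<subseteq> encoders T A \<and>
      (\<forall>t\<in>T. measure_pmf.expectation \<nu> (\<lambda>C. (u / (2 * p)) *\<^sub>R tau T C t) \<in> K t)"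
    by (rule expectation_in_product_if_no_separation[OF assms(1) \<open>inj_on A T\<close> finite_encoders[OF assms(1)]])
      (fact assms no_sep)+
  then obtain \<nu> where \<nu>: "set_pmf \<nu> \<subseteq> encoders T A"
    and in_K: "\<forall>t\<in>T. measure_pmf.expectation \<nu> (\<lambda>C. (u / (2 * p)) *\<^sub>R tau T C t) \<in> K t"
    by blast
  define b where "b t = measure_pmf.expectation \<nu> (\<lambda>C. tau T C t)" for t
  \<comment> \<open>The scaling by \<open>u / (2 * p)\<close> turns the level \<open>p / 4\<close> for \<open>b\<close> into the required level \<open>u / 8\<close>.\<close>
  define \<delta> where "\<delta> = (real n + 1) * 4 ^ n * exp (p / 4)"
  have "\<delta> \<ge> 0" by (simp add: \<delta>_def)
  have "real (card {t \<in> T. mass (b t) (A t - A s) < p / 4}) \<le> \<delta>" if "s \<in> T" for s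
    unfolding b_def \<delta>_def
    by (rule few_labels_with_little_mass[OF assms(1) \<nu> card_A card_A[OF that]])
  from independent_set_of_bounded_indegree
      [where R = "\<lambda>t s. mass (b t) (A t - A s) < p / 4", OF assms(1) this]
  obtain I where I: "I \<subseteq> T" "real (card T) \<le> (1 + 2 * \<delta>) * real (card I)"
      "\<forall>t\<in>I. \<forall>s\<in>I. t \<noteq> s \<longrightarrow> \<not> mass (b t) (A t - A s) < p / 4" by blast
  have card_I: "real (card I) \<ge> exp p / (1 + 2 * \<delta>)"
    using I(2) \<open>\<delta> \<ge> 0\<close> by (simp add: exp_p divide_le_eq mult.commute)
  have mass_I: "mass ((u / (2 * p)) *\<^sub>R b t) (A t - A s) \<ge> u / 8" if "t \<in> I" "s \<in> I" "t \<noteq> s" for s t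
  proof -
    have "u / 8 = u / (2 * p) * (p / 4)" using p_pos by simp
    also have "\<dots> \<le> u / (2 * p) * mass (b t) (A t - A s)"
      using I(3) that p_pos assms(11) by (intro mult_left_mono) (auto simp: not_less)
    finally show ?thesis by (simp add: mass_def sum_distrib_left)
  qed
  have large: "real (card I) \<ge> exp (p / 2)" if "m \<ge> 1" "real_of_int m \<le> p / 64"
    using exp_half_le_of_small_alphabet[of n p] that card_I by (simp add: m \<delta>_def)
  have "2 * ((real_of_int m + 1) * 4 powi m) * exp (p / 4) = 2 * \<delta>"
    by (simp add: m \<delta>_def)
  then show ?thesis
    using \<nu> in_K I(1) card_I mass_I large unfolding Let_def b_def
    by (intro exI[of _ \<nu>] conjI exI[of _ I]) (auto simp: mult.assoc)
qed

end
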